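(* Let $n\in\mathbb{N}$, let $S_1,\ldots,S_n$ be finite semigroups, let $S=\prod_{i=1}^n S_i$ be their direct product, and let $C=\{i\in\{1,\ldots,n\}: S_i\text{ is commutative}\}$ and $\mathit{NC}=\{i\in\{1,\ldots,n\}: S_i\text{ is not commutative}\}$. Suppose that $\mathit{NC}\neq\emptyset$. Then $\mathcal{G}(S)$ contains cycles if and only if at least one of the following conditions holds: (1) There exists $i\in C$ such that $|S_i|\geqslant 3$. (2) There exist distinct $i,j\in C$ such that $|S_i|\geqslant 2$ and $|S_j|\geqslant 2$. (3) There exist $i\in C$ and $j\in\mathit{NC}$ such that $|S_i|\geqslant 2$ and $\mathcal{G}(S_j)$ is not a null graph. (4) $|\mathit{NC}|\geqslant 2$ and there exist $i\in C$ and $j\in\mathit{NC}$ such that $|S_i|\geqslant 2$ and $Z(S_j)\neq\emptyset$. (5) There exist distinct $i,j\in\mathit{NC}$ such that ($Z(S_i)\neq\emptyset$ or $\mathcal{G}(S_i)$ is not a null graph) and ($Z(S_j)\neq\emptyset$ or $\mathcal{G}(S_j)$ is not a null graph). (6) $|\mathit{NC}|\geqslant 2$ and there exists $i\in\mathit{NC}$ such that $|Z(S_i)|\geqslant 2$. (7) $|\mathit{NC}|\geqslant 2$ and there exists $i\in\mathit{NC}$ such that $Z(S_i)\neq\emptyset$ and $\mathcal{G}(S_i)$ is not a null graph. (8) There exists $i\in\mathit{NC}$ such that $\mathcal{G}(S_i)$ contains cycles. Furthermore, if at least one of the conditions (1)--(7) is satisfied, then $\mathrm{girth}(\mathcal{G}(S))=3$;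 and if condition (8) is the only one that is satisfied, then there exists a unique $i\in\mathit{NC}$ such that $\mathcal{G}(S_i)$ contains cycles, and $\mathrm{girth}(\mathcal{G}(S))=\mathrm{girth}(\mathcal{G}(S_i))$.
   Context: Semigroups are non-empty. The direct product $\prod_{i=1}^n S_i$ is the cartesian product with componentwise multiplication. The center of a semigroup $T$ is $Z(T)=\{x\in T: xy=yx \text{ for all } y\in T\}$ (possibly empty). For a finite non-commutative semigroup $T$, the commuting graph $\mathcal{G}(T)$ is the simple graph with vertex set $T\setminus Z(T)$ in which two distinct vertices $x,y$ are adjacent if and only if $xy=yx$. A null graph is a simple graph with no edges. The girth of a graph containing cycles is the length of a shortest cycle. *)

theory Defs
  imports
    "HOL-Algebra.Congruence"
    "HOL-Library.FuncSet"
    "HOL-Library.Extended_Nat"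
    "Graph_Theory.Graph_Theory"
begin

section \<open>Semigroups with explicit carrier\<close>

record 'a magma = "'a partial_object" +
  mult :: "'a \<Rightarrow> 'a \<Rightarrow> 'a" (infixl \<open>\<cdot>\<index>\<close> 70)

text \<open>Semigroups are non-empty.\<close>

locale carrier_semigroup =
  fixes T :: "('a, 'b) magma_scheme" (structure)
  assumes nonempty: "carrier T \<noteq> {}"
    and closed: "\<lbrakk>x \<in> carrier T; y \<in> carrier T\<rbrakk> \<Longrightarrow> x \<cdot> y \<in> carrier T"
    and assoc: "\<lbrakk>x \<in> carrier T; y \<in> carrier T; z \<in> carrier T\<rbrakk>
      \<Longrightarrow> (x \<cdot> y) \<cdot> z = x \<cdot> (y \<cdot> z)"

locale finite_semigroup = carrier_semigroup +
  assumes finite_carrier: "finite (carrier T)"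

definition commutative :: "('a, 'b) magma_scheme \<Rightarrow> bool" where
  "commutative T \<longleftrightarrow> (\<forall>x\<in>carrier T. \<forall>y\<in>carrier T. x \<cdot>\<^bsub>T\<^esub> y = y \<cdot>\<^bsub>T\<^esub> x)"

definition center :: "('a, 'b) magma_scheme \<Rightarrow> 'a set" where
  "center T = {x \<in> carrier T. \<forall>y\<in>carrier T. x \<cdot>\<^bsub>T\<^esub> y = y \<cdot>\<^bsub>T\<^esub> x}"

definition direct_product :: "'i set \<Rightarrow> ('i \<Rightarrow> ('a, 'b) magma_scheme) \<Rightarrow> ('i \<Rightarrow> 'a) magma" where
  "direct_product I S =
    \<lparr>carrier = (\<Pi>\<^sub>E i\<in>I. carrier (S i)),
     mult = (\<lambda>x y. \<lambda>i\<in>I. x i \<cdot>\<^bsub>S i\<^esub> y i)\<rparr>"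


section \<open>Simple graphs, cycles and girth\<close>

text \<open>
  Simple graphs are represented as in \<^locale>\<open>pair_graph\<close>: each undirected edge is the pair of
  arcs in both directions.
\<close>

definition null_graph :: "'a pair_pre_digraph \<Rightarrow> bool" where
  "null_graph G \<longleftrightarrow> parcs G = {}"

text \<open>
  The library's \<^const>\<open>pre_digraph.cycle\<close> is meant for digraphs, so it also accepts the walk
  \<open>u, v, u\<close> along the two arcs of one undirected edge. For symmetric loop-free digraphs without
  parallel arcs, these are exactly the cycles of length less than 3.
\<close>

definition graph_cycle :: "'a pair_pre_digraph \<Rightarrow> ('a \<times> 'a) list \<Rightarrow> bool" where
  "graph_cycle G p \<longleftrightarrow> pre_digraph.cycle (with_proj G) p \<and> 3 \<le> length p"

definition contains_cycles :: "'a pair_pre_digraph \<Rightarrow> bool" where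
  "contains_cycles G \<longleftrightarrow> (\<exists>p. graph_cycle G p)"

text \<open>The girth is \<open>\<infinity>\<close> for graphs without cycles.\<close>

definition girth :: "'a pair_pre_digraph \<Rightarrow> enat" where
  "girth G = (INF p \<in> {p. graph_cycle G p}. enat (length p))"


section \<open>Commuting graphs\<close>

definition commuting_graph :: "('a, 'b) magma_scheme \<Rightarrow> 'a pair_pre_digraph" where
  "commuting_graph T =
    \<lparr>pverts = carrier T - center T,
     parcs = {(x, y). x \<in> carrier T - center T \<and> y \<in> carrier T - center T \<and>
                      x \<noteq> y \<and> x \<cdot>\<^bsub>T\<^esub> y = y \<cdot>\<^bsub>T\<^esub> x}\<rparr>"

lemma pair_graph_commuting_graph:
  assumes "finite (carrier T)"
  shows "pair_graph (commuting_graph T)"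
proof
  show "finite (parcs (commuting_graph T))"
    by (rule finite_subset[of _ "carrier T \<times> carrier T"])
      (use assms in \<open>auto simp: commuting_graph_def\<close>)
qed (use assms in \<open>auto simp: commuting_graph_def symmetric_def intro: symI\<close>)

end

theory Submission
  imports Defs
begin

text \<open>
  Multiplication in a direct product is componentwise, so two tuples commute if and only if they
  commute in every coordinate, and a tuple is a vertex of the commuting graph if and only if some
  coordinate of it is non-central. All cycles come from two sources.

  The first is the interaction of coordinates. Suppose that the vertices
  \<open>x\<close>, \<open>x(i := a)\<close>, \<open>x(j := b)\<close> differ from each other and that \<open>a\<close>, \<open>b\<close> commute with the entries
  they replace. If \<open>i \<noteq> j\<close>, these three commute pairwise, and if \<open>i = j\<close> they do so as soon as \<open>a\<close>
  and \<open>b\<close> commute. Each of the first seven conditions supplies such a triangle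
  (\<open>triangle_if_interaction\<close>), so the girth is 3 because no cycle is shorter.

  The second source is a cycle in a single non-commutative factor: freezing all other coordinates
  lifts it to a cycle of the same length in the product (\<open>cycle_lifts\<close>).

  Conversely, suppose that none of the seven conditions holds. Two edges of the product that move
  different coordinates would force one of the conditions 2 to 5, so there is one coordinate \<open>k\<close> that
  every edge moves, while it fixes the others (\<open>arcs_move_same_coordinate\<close>). In the
  presence of a cycle, \<open>k\<close> cannot be a commutative factor, which has at most two
  elements, and no vertex can be central at \<open>k\<close>: otherwise the centre of the factor would
  consist of one element \<open>z\<close>, and every edge of the product would have exactly one end with value \<open>z\<close>
  at \<open>k\<close>, so that the edges would form disjoint stars. Hence evaluation at \<open>k\<close> maps the cycle to a
  cycle of the same length in the commuting graph of the \<open>k\<close>-th factor (\<open>cycle_projects\<close>).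
  Lifting and projecting give the equality of the girths. The factor is unique, since two factors with cycles have edges and satisfy
  condition 5.
\<close>

section \<open>Cycles in simple graphs\<close>

lemma graph_cycle_iff:
  "graph_cycle G p \<longleftrightarrow> (\<exists>u. u \<in> pverts G \<and> set p \<subseteq> parcs G \<and> pcas u p u) \<and>
     distinct (map snd p) \<and> 3 \<le> length p"
proof -
  have "pawalk_verts u p = u # map snd p" if "pcas u p v" for u v
    using that by (induction u p v rule: pcas.induct) auto
  then show ?thesis
    unfolding graph_cycle_def pre_digraph.cycle_def pre_digraph.awalk_def
      cas_with_proj_eq awalk_verts_with_proj_eq by fastforce
qed

lemma graph_cycle_length: "graph_cycle G p \<Longrightarrow> 3 \<le> length p"
  by (simp add: graph_cycle_def)

lemma girth_le: "graph_cycle G p \<Longrightarrow> girth G \<le> enat (length p)"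
  unfolding girth_def by (rule INF_lower) simp

lemma girth_ge: "(\<And>p. graph_cycle G p \<Longrightarrow> m \<le> enat (length p)) \<Longrightarrow> m \<le> girth G"
  unfolding girth_def by (rule INF_greatest) simp

lemma triangle_graph_cycle:
  assumes "x \<in> pverts G" "(x, y) \<in> parcs G" "(y, z) \<in> parcs G" "(z, x) \<in> parcs G"
    and "x \<noteq> y" "y \<noteq> z" "z \<noteq> x"
  shows "graph_cycle G [(x, y), (y, z), (z, x)]"
  using assms by (auto simp: graph_cycle_iff)

lemma graph_cycle_imp_arc:
  assumes "graph_cycle G p"
  shows "parcs G \<noteq> {}"
  using assms by (cases p) (auto simp: graph_cycle_iff)

lemma contains_cycles_not_null: "contains_cycles G \<Longrightarrow> \<not> null_graph G"
  by (auto simp: contains_cycles_def null_graph_def dest: graph_cycle_imp_arc)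

text \<open>
  The vertices \<open>u\<close> and \<open>x\<close> may coincide, namely when the cycle is a triangle; so this walk along
  three arcs treats triangles and longer cycles alike.
\<close>

lemma graph_cycle_three_arcs:
  assumes "graph_cycle G p"
  obtains u v w x where "(u, v) \<in> parcs G" "(v, w) \<in> parcs G" "(w, x) \<in> parcs G"
    and "u \<noteq> w" "v \<noteq> x"
proof -
  obtain s where s: "set p \<subseteq> parcs G" "pcas s p s" "distinct (map snd p)" "3 \<le> length p"
    using assms by (auto simp: graph_cycle_iff)
  obtain a p' where p1: "p = a # p'" using s(4) by (cases p) auto
  obtain b p'' where p2: "p' = b # p''" using s(4) p1 by (cases p') auto
  obtain c r where p3: "p'' = c # r" using s(4) p1 p2 by (cases p'') auto
  obtain v w x where eqs: "a = (s, v)" "b = (v, w)" "c = (w, x)" and r: "pcas x r s"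
    using s(2) by (cases a, cases b, cases c) (auto simp: p1 p2 p3)
  have "s = x \<or> s \<in> snd ` set r"
    using r by (induction x r s rule: pcas.induct) auto
  then have "s \<noteq> w" "v \<noteq> x"
    using s(3) by (auto simp: p1 p2 p3 eqs)
  then show thesis
    using that[of s v w x] s(1) by (auto simp: p1 p2 p3 eqs)
qed

lemma pcas_map: "pcas u p v \<Longrightarrow> pcas (f u) (map (map_prod f f) p) (f v)"
  by (induction u p v rule: pcas.induct) auto

lemma graph_cycle_map:
  assumes cyc: "graph_cycle G p"
    and vert: "\<And>x. x \<in> pverts G \<Longrightarrow> f x \<in> pverts H"
    and arc: "\<And>x y. (x, y) \<in> parcs G \<Longrightarrow> (f x, f y) \<in> parcs H"
    and inj: "inj_on f (snd ` set p)"
  shows "graph_cycle H (map (map_prod f f) p)"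
proof -
  obtain s where s: "s \<in> pverts G" "set p \<subseteq> parcs G" "pcas s p s" "distinct (map snd p)"
      "3 \<le> length p"
    using cyc by (auto simp: graph_cycle_iff)
  have "map snd (map (map_prod f f) p) = map f (map snd p)"
    by simp
  then have "distinct (map snd (map (map_prod f f) p))"
    using s(4) inj by (metis distinct_map list.set_map)
  moreover have "set (map (map_prod f f) p) \<subseteq> parcs H"
    using s(2) arc by auto
  ultimately show ?thesis
    using s(1,5) vert pcas_map[OF s(3), of f] unfolding graph_cycle_iff by auto
qed

section \<open>Commuting graphs\<close>

lemma commuting_graph_verts [simp]: "pverts (commuting_graph T) = carrier T - center T"
  by (simp add: commuting_graph_def)

lemma commuting_graph_arc_iff [simp]:
  "(x, y) \<in> parcs (commuting_graph T) \<longleftrightarrow>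
     x \<in> carrier T - center T \<and> y \<in> carrier T - center T \<and> x \<noteq> y \<and> x \<cdot>\<^bsub>T\<^esub> y = y \<cdot>\<^bsub>T\<^esub> x"
  by (simp add: commuting_graph_def)

lemma center_commute:
  "z \<in> center T \<Longrightarrow> x \<in> carrier T \<Longrightarrow> z \<cdot>\<^bsub>T\<^esub> x = x \<cdot>\<^bsub>T\<^esub> z"
  by (simp add: center_def)

lemma center_carrier: "z \<in> center T \<Longrightarrow> z \<in> carrier T"
  by (simp add: center_def)

lemma null_commuting_graph_iff:
  "null_graph (commuting_graph T) \<longleftrightarrow>
     (\<forall>x\<in>carrier T. \<forall>y\<in>carrier T. x \<noteq> y \<longrightarrow> x \<cdot>\<^bsub>T\<^esub> y = y \<cdot>\<^bsub>T\<^esub> x \<longrightarrow> x \<in> center T \<or> y \<in> center T)"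
  by (auto simp: null_graph_def commuting_graph_def)

lemma not_null_commuting_graphE:
  assumes "\<not> null_graph (commuting_graph T)"
  obtains s t where "s \<in> carrier T - center T" "t \<in> carrier T - center T" "s \<noteq> t"
    "s \<cdot>\<^bsub>T\<^esub> t = t \<cdot>\<^bsub>T\<^esub> s"
  using assms by (auto simp: null_commuting_graph_iff)

lemma not_commutativeE:
  assumes "\<not> commutative T"
  obtains s where "s \<in> carrier T - center T"
  using assms by (auto simp: commutative_def center_def)

lemma noncentral_not_commutative: "s \<in> carrier T - center T \<Longrightarrow> \<not> commutative T"
  by (auto simp: commutative_def center_def)

text \<open>
  For a non-commutative factor, \<open>center T \<noteq> {} \<or> \<not> null_graph (commuting_graph T)\<close> is the condition
  that two different elements commute; one of them can then be chosen non-central, because a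
  central element commutes with any non-central one.
\<close>

lemma noncentral_commuting_pair:
  assumes "\<not> commutative T" and "center T \<noteq> {} \<or> \<not> null_graph (commuting_graph T)"
  obtains s t where "s \<in> carrier T - center T" "t \<in> carrier T" "s \<noteq> t"
    "s \<cdot>\<^bsub>T\<^esub> t = t \<cdot>\<^bsub>T\<^esub> s"
  using assms(2)
proof
  assume "center T \<noteq> {}"
  then obtain z where z: "z \<in> center T" by auto
  obtain s where s: "s \<in> carrier T - center T" using assms(1) by (rule not_commutativeE)
  show thesis using that[of s z] s z center_commute[of z T s] center_carrier[of z T] by auto
next
  assume "\<not> null_graph (commuting_graph T)"
  then show thesis by (rule not_null_commuting_graphE) (use that in blast)
qed

lemma commuting_pair_imp_center_or_edge:
  assumes "s \<in> carrier T" "t \<in> carrier T" "s \<noteq> t" "s \<cdot>\<^bsub>T\<^esub> t = t \<cdot>\<^bsub>T\<^esub> s"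
  shows "center T \<noteq> {} \<or> \<not> null_graph (commuting_graph T)"
  using assms unfolding null_commuting_graph_iff by blast

lemma card_ge_2E:
  assumes "2 \<le> card A"
  obtains a b where "a \<in> A" "b \<in> A" "a \<noteq> b"
  using assms by (auto simp: card_le_Suc_iff numeral_eq_Suc)

lemma card_ge_3E:
  assumes "3 \<le> card A"
  obtains a b c where "a \<in> A" "b \<in> A" "c \<in> A" "a \<noteq> b" "b \<noteq> c" "a \<noteq> c"
  using assms by (auto simp: card_le_Suc_iff numeral_eq_Suc)

lemma card_ge_2I:
  assumes "finite A" "a \<in> A" "b \<in> A" "a \<noteq> b"
  shows "2 \<le> card A"
  using card_mono[of A "{a, b}"] assms by simp

lemma card_ge_3I:
  assumes "finite A" "a \<in> A" "b \<in> A" "c \<in> A" "a \<noteq> b" "b \<noteq> c" "a \<noteq> c"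
  shows "3 \<le> card A"
  using card_mono[of A "{a, b, c}"] assms by simp

section \<open>Direct products\<close>

locale finite_semigroup_family =
  fixes I :: "'i set" and S :: "'i \<Rightarrow> ('a, 'b) magma_scheme"
  assumes finite_index: "finite I"
    and factor: "i \<in> I \<Longrightarrow> finite_semigroup (S i)"
begin

abbreviation P where "P \<equiv> direct_product I S"

definition comm_idx :: "'i set" where "comm_idx = {i \<in> I. commutative (S i)}"

definition noncomm_idx :: "'i set" where "noncomm_idx = {i \<in> I. \<not> commutative (S i)}"

lemma comm_idx_index: "i \<in> comm_idx \<Longrightarrow> i \<in> I"
  by (simp add: comm_idx_def)

lemma noncomm_idx_index: "i \<in> noncomm_idx \<Longrightarrow> i \<in> I"
  by (simp add: noncomm_idx_def)

lemma comm_idx_commute: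
  "i \<in> comm_idx \<Longrightarrow> a \<in> carrier (S i) \<Longrightarrow> b \<in> carrier (S i) \<Longrightarrow> a \<cdot>\<^bsub>S i\<^esub> b = b \<cdot>\<^bsub>S i\<^esub> a"
  by (simp add: comm_idx_def commutative_def)

lemma finite_noncomm_idx: "finite noncomm_idx"
  using finite_index by (simp add: noncomm_idx_def)

lemma factor_finite: "i \<in> I \<Longrightarrow> finite (carrier (S i))"
  using factor finite_semigroup.finite_carrier by blast

lemma factor_nonempty: "i \<in> I \<Longrightarrow> carrier (S i) \<noteq> {}"
  using factor carrier_semigroup.nonempty finite_semigroup.axioms(1) by blast

lemma carrier_P: "carrier P = (\<Pi>\<^sub>E i\<in>I. carrier (S i))"
  by (simp add: direct_product_def)

lemma carrier_coord: "x \<in> carrier P \<Longrightarrow> i \<in> I \<Longrightarrow> x i \<in> carrier (S i)"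
  by (auto simp: carrier_P)

lemma carrier_upd: "x \<in> carrier P \<Longrightarrow> i \<in> I \<Longrightarrow> a \<in> carrier (S i) \<Longrightarrow> x(i := a) \<in> carrier P"
  by (auto simp: carrier_P PiE_def extensional_def)

lemma carrier_P_nonempty: obtains x where "x \<in> carrier P"
  using factor_nonempty by (metis PiE_eq_empty_iff all_not_in_conv carrier_P)

lemma carrier_eqI:
  "x \<in> carrier P \<Longrightarrow> y \<in> carrier P \<Longrightarrow> (\<And>i. i \<in> I \<Longrightarrow> x i = y i) \<Longrightarrow> x = y"
  unfolding carrier_P by (rule PiE_ext)

lemma mult_P_commute_iff:
  "x \<cdot>\<^bsub>P\<^esub> y = y \<cdot>\<^bsub>P\<^esub> x \<longleftrightarrow> (\<forall>i\<in>I. x i \<cdot>\<^bsub>S i\<^esub> y i = y i \<cdot>\<^bsub>S i\<^esub> x i)"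
  by (auto simp: direct_product_def restrict_def fun_eq_iff)

lemma center_P_iff:
  assumes "x \<in> carrier P"
  shows "x \<in> center P \<longleftrightarrow> (\<forall>i\<in>I. x i \<in> center (S i))"
proof
  assume x: "x \<in> center P"
  show "\<forall>i\<in>I. x i \<in> center (S i)"
  proof
    fix i assume i: "i \<in> I"
    have "x i \<cdot>\<^bsub>S i\<^esub> a = a \<cdot>\<^bsub>S i\<^esub> x i" if "a \<in> carrier (S i)" for a
    proof -
      have "x \<cdot>\<^bsub>P\<^esub> x(i := a) = x(i := a) \<cdot>\<^bsub>P\<^esub> x"
        using x carrier_upd[OF assms i that] by (rule center_commute)
      then show ?thesis using i by (auto simp: mult_P_commute_iff)
    qed
    then show "x i \<in> center (S i)" using assms i by (simp add: center_def carrier_coord)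
  qed
next
  assume "\<forall>i\<in>I. x i \<in> center (S i)"
  then show "x \<in> center P"
    using assms by (auto simp: center_def mult_P_commute_iff carrier_coord)
qed

lemma noncentral_upd:
  assumes "x \<in> carrier P" "i \<in> I" "a \<in> carrier (S i)"
    and "a \<notin> center (S i) \<or> (\<exists>k\<in>I. k \<noteq> i \<and> x k \<notin> center (S k))"
  shows "x(i := a) \<in> carrier P - center P"
  using assms carrier_upd center_P_iff[of "x(i := a)"] by fastforce

lemma noncentral_coord_noncomm_idx:
  assumes "x \<in> carrier P" "k \<in> I" "x k \<notin> center (S k)"
  shows "k \<in> noncomm_idx"
  using assms noncentral_not_commutative[of "x k" "S k"] by (auto simp: noncomm_idx_def carrier_coord)

section \<open>Triangles from interacting coordinates\<close>

text \<open>
  A non-central value at \<open>k\<close> makes every tuple a vertex, so \<open>a\<close>, \<open>b\<close>, \<open>c\<close> themselves may be central.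
\<close>

lemma triangle_one_coordinate:
  assumes i: "i \<in> I" and k: "k \<in> noncomm_idx" "k \<noteq> i"
    and abc: "a \<in> carrier (S i)" "b \<in> carrier (S i)" "c \<in> carrier (S i)"
      "a \<noteq> b" "b \<noteq> c" "a \<noteq> c"
    and comm: "a \<cdot>\<^bsub>S i\<^esub> b = b \<cdot>\<^bsub>S i\<^esub> a" "b \<cdot>\<^bsub>S i\<^esub> c = c \<cdot>\<^bsub>S i\<^esub> b" "a \<cdot>\<^bsub>S i\<^esub> c = c \<cdot>\<^bsub>S i\<^esub> a"
  shows "\<exists>p. graph_cycle (commuting_graph P) p \<and> length p = 3"
proof -
  obtain x0 where x0: "x0 \<in> carrier P" by (rule carrier_P_nonempty)
  obtain s where s: "s \<in> carrier (S k) - center (S k)"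
    using k(1) by (auto simp: noncomm_idx_def elim: not_commutativeE)
  define x where "x = x0(k := s)"
  have kI: "k \<in> I" using k(1) by (rule noncomm_idx_index)
  have x: "x \<in> carrier P" "x k \<notin> center (S k)"
    using x0 s kI by (auto simp: x_def intro!: carrier_upd)
  have vert: "x(i := d) \<in> carrier P - center P" if "d \<in> carrier (S i)" for d
    using x kI k(2) i that by (intro noncentral_upd) auto
  have neq: "x(i := d) \<noteq> x(i := e)" if "d \<noteq> e" for d e
    using that by (metis fun_upd_same)
  have comm_upd: "x(i := d) \<cdot>\<^bsub>P\<^esub> x(i := e) = x(i := e) \<cdot>\<^bsub>P\<^esub> x(i := d)"
    if "d \<cdot>\<^bsub>S i\<^esub> e = e \<cdot>\<^bsub>S i\<^esub> d" for d e
    using that by (simp add: mult_P_commute_iff)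
  have "graph_cycle (commuting_graph P)
          [(x(i := a), x(i := b)), (x(i := b), x(i := c)), (x(i := c), x(i := a))]"
    using abc comm by (intro triangle_graph_cycle) (auto simp: neq vert[simplified] intro!: comm_upd)
  then show ?thesis by force
qed

lemma triangle_two_coordinates:
  assumes ij: "i \<in> I" "j \<in> I" "i \<noteq> j"
    and x: "x \<in> carrier P - center P"
    and a: "x(i := a) \<in> carrier P - center P" "a \<noteq> x i" "a \<cdot>\<^bsub>S i\<^esub> x i = x i \<cdot>\<^bsub>S i\<^esub> a"
    and b: "x(j := b) \<in> carrier P - center P" "b \<noteq> x j" "b \<cdot>\<^bsub>S j\<^esub> x j = x j \<cdot>\<^bsub>S j\<^esub> b"
  shows "\<exists>p. graph_cycle (commuting_graph P) p \<and> length p = 3"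
proof -
  have neq: "x \<noteq> x(i := a)" "x(i := a) \<noteq> x(j := b)" "x(j := b) \<noteq> x"
    using a(2) b(2) ij(3) by (auto simp: fun_eq_iff)
  have "graph_cycle (commuting_graph P)
          [(x, x(i := a)), (x(i := a), x(j := b)), (x(j := b), x)]"
    using neq x a b ij(3) by (intro triangle_graph_cycle) (auto simp: mult_P_commute_iff)
  then show ?thesis by force
qed

text \<open>
  The shape in which the previous lemma is applied: of the pairs \<open>(a, c)\<close>, \<open>(b, c)\<close>, \<open>(a, d)\<close> each
  must be non-central, either on its own account or because of a third coordinate.
\<close>

lemma triangle_two_pairs:
  assumes ij: "i \<in> I" "j \<in> I" "i \<noteq> j"
    and ab: "a \<in> carrier (S i)" "b \<in> carrier (S i)" "a \<noteq> b" "a \<cdot>\<^bsub>S i\<^esub> b = b \<cdot>\<^bsub>S i\<^esub> a"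
    and cd: "c \<in> carrier (S j)" "d \<in> carrier (S j)" "c \<noteq> d" "c \<cdot>\<^bsub>S j\<^esub> d = d \<cdot>\<^bsub>S j\<^esub> c"
    and noncentral: "(\<exists>k\<in>noncomm_idx. k \<noteq> i \<and> k \<noteq> j) \<or>
      (c \<notin> center (S j) \<and> (a \<notin> center (S i) \<or> d \<notin> center (S j)))"
  shows "\<exists>p. graph_cycle (commuting_graph P) p \<and> length p = 3"
proof -
  obtain x0 where x0: "x0 \<in> carrier P"
    "c \<notin> center (S j) \<and> (a \<notin> center (S i) \<or> d \<notin> center (S j)) \<or>
       (\<exists>k\<in>I. k \<noteq> i \<and> k \<noteq> j \<and> x0 k \<notin> center (S k))"
  proof (cases "\<exists>k\<in>noncomm_idx. k \<noteq> i \<and> k \<noteq> j")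
    case True
    then obtain k where k: "k \<in> noncomm_idx" "k \<noteq> i" "k \<noteq> j" by auto
    obtain s where s: "s \<in> carrier (S k) - center (S k)"
      using k(1) by (auto simp: noncomm_idx_def elim: not_commutativeE)
    obtain y where "y \<in> carrier P" by (rule carrier_P_nonempty)
    then have "y(k := s) \<in> carrier P"
      using s k(1) noncomm_idx_index by (intro carrier_upd) auto
    then show thesis
      using that[of "y(k := s)"] s k noncomm_idx_index by fastforce
  next
    case False
    then show thesis using noncentral carrier_P_nonempty that by blast
  qed
  have upd: "x0(i := a') \<in> carrier P" if "a' \<in> carrier (S i)" for a'
    using x0(1) ij(1) that by (rule carrier_upd)
  define x where "x = x0(i := a, j := c)"
  have xi: "x i = a" "x j = c" using ij(3) by (auto simp: x_def)
  have x_b: "x(i := b) = x0(i := b, j := c)" and x_d: "x(j := d) = x0(i := a, j := d)"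
    using ij(3) by (auto simp: x_def fun_eq_iff)
  have "x \<in> carrier P - center P" unfolding x_def
    using upd[OF ab(1)] ij cd x0(2) by (intro noncentral_upd) auto
  moreover have "x(i := b) \<in> carrier P - center P" unfolding x_b
    using upd[OF ab(2)] ij cd x0(2) by (intro noncentral_upd) auto
  moreover have "x(j := d) \<in> carrier P - center P" unfolding x_d
    using upd[OF ab(1)] ij cd x0(2) by (intro noncentral_upd) auto
  ultimately show ?thesis
    using triangle_two_coordinates[of i j x b d] ij ab cd xi by auto
qed

lemma other_noncomm_idx:
  assumes "2 \<le> card noncomm_idx"
  obtains k where "k \<in> noncomm_idx" "k \<noteq> i"
  using assms by (metis card_ge_2E)

text \<open>
  These are the first seven conditions, in order: the ones under which the product has a triangle
  whatever cycles the factors have.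
\<close>

definition interaction :: bool where
  "interaction \<longleftrightarrow>
     (\<exists>i\<in>comm_idx. 3 \<le> card (carrier (S i))) \<or>
     (\<exists>i\<in>comm_idx. \<exists>j\<in>comm_idx. i \<noteq> j \<and>
        2 \<le> card (carrier (S i)) \<and> 2 \<le> card (carrier (S j))) \<or>
     (\<exists>i\<in>comm_idx. \<exists>j\<in>noncomm_idx.
        2 \<le> card (carrier (S i)) \<and> \<not> null_graph (commuting_graph (S j))) \<or>
     (2 \<le> card noncomm_idx \<and> (\<exists>i\<in>comm_idx. \<exists>j\<in>noncomm_idx.
        2 \<le> card (carrier (S i)) \<and> center (S j) \<noteq> {})) \<or>
     (\<exists>i\<in>noncomm_idx. \<exists>j\<in>noncomm_idx. i \<noteq> j \<and>
        (center (S i) \<noteq> {} \<or> \<not> null_graph (commuting_graph (S i))) \<and>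
        (center (S j) \<noteq> {} \<or> \<not> null_graph (commuting_graph (S j)))) \<or>
     (2 \<le> card noncomm_idx \<and> (\<exists>i\<in>noncomm_idx. 2 \<le> card (center (S i)))) \<or>
     (2 \<le> card noncomm_idx \<and> (\<exists>i\<in>noncomm_idx.
        center (S i) \<noteq> {} \<and> \<not> null_graph (commuting_graph (S i))))"

lemma interactionI:
  "i \<in> comm_idx \<Longrightarrow> 3 \<le> card (carrier (S i)) \<Longrightarrow> interaction"
  "i \<in> comm_idx \<Longrightarrow> j \<in> comm_idx \<Longrightarrow> i \<noteq> j \<Longrightarrow> 2 \<le> card (carrier (S i)) \<Longrightarrow>
     2 \<le> card (carrier (S j)) \<Longrightarrow> interaction"
  "i \<in> comm_idx \<Longrightarrow> j \<in> noncomm_idx \<Longrightarrow> 2 \<le> card (carrier (S i)) \<Longrightarrow>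
     \<not> null_graph (commuting_graph (S j)) \<Longrightarrow> interaction"
  "2 \<le> card noncomm_idx \<Longrightarrow> i \<in> comm_idx \<Longrightarrow> j \<in> noncomm_idx \<Longrightarrow>
     2 \<le> card (carrier (S i)) \<Longrightarrow> z \<in> center (S j) \<Longrightarrow> interaction"
  "i \<in> noncomm_idx \<Longrightarrow> j \<in> noncomm_idx \<Longrightarrow> i \<noteq> j \<Longrightarrow>
     center (S i) \<noteq> {} \<or> \<not> null_graph (commuting_graph (S i)) \<Longrightarrow>
     center (S j) \<noteq> {} \<or> \<not> null_graph (commuting_graph (S j)) \<Longrightarrow> interaction"
  "2 \<le> card noncomm_idx \<Longrightarrow> i \<in> noncomm_idx \<Longrightarrow> 2 \<le> card (center (S i)) \<Longrightarrow> interaction"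
  "2 \<le> card noncomm_idx \<Longrightarrow> i \<in> noncomm_idx \<Longrightarrow> z \<in> center (S i) \<Longrightarrow>
     \<not> null_graph (commuting_graph (S i)) \<Longrightarrow> interaction"
  unfolding interaction_def
  subgoal by (rule disjI1) blast
  subgoal by (rule disjI2, rule disjI1) blast
  subgoal by (rule disjI2, rule disjI2, rule disjI1) blast
  subgoal by (rule disjI2, rule disjI2, rule disjI2, rule disjI1) blast
  subgoal by (rule disjI2, rule disjI2, rule disjI2, rule disjI2, rule disjI1) blast
  subgoal by (rule disjI2, rule disjI2, rule disjI2, rule disjI2, rule disjI2, rule disjI1) blast
  subgoal by (rule disjI2, rule disjI2, rule disjI2, rule disjI2, rule disjI2, rule disjI2) blast
  done

text \<open>
  Conditions 1, 6 and 7 give three commuting elements in one factor, the others two commuting pairs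
  in two different factors.
\<close>

lemma triangle_if_interaction:
  assumes "noncomm_idx \<noteq> {}" and "interaction"
  shows "\<exists>p. graph_cycle (commuting_graph P) p \<and> length p = 3"
proof -
  have disj: "i \<noteq> j" if "i \<in> comm_idx" "j \<in> noncomm_idx" for i j
    using that by (auto simp: comm_idx_def noncomm_idx_def)
  from assms(2) consider
      (c1) i where "i \<in> comm_idx" "3 \<le> card (carrier (S i))"
    | (c2) i j where "i \<in> comm_idx" "j \<in> comm_idx" "i \<noteq> j"
        "2 \<le> card (carrier (S i))" "2 \<le> card (carrier (S j))"
    | (c3) i j where "i \<in> comm_idx" "j \<in> noncomm_idx"
        "2 \<le> card (carrier (S i))" "\<not> null_graph (commuting_graph (S j))"
    | (c4) i j where "2 \<le> card noncomm_idx" "i \<in> comm_idx" "j \<in> noncomm_idx"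
        "2 \<le> card (carrier (S i))" "center (S j) \<noteq> {}"
    | (c5) i j where "i \<in> noncomm_idx" "j \<in> noncomm_idx" "i \<noteq> j"
        "center (S i) \<noteq> {} \<or> \<not> null_graph (commuting_graph (S i))"
        "center (S j) \<noteq> {} \<or> \<not> null_graph (commuting_graph (S j))"
    | (c6) i where "2 \<le> card noncomm_idx" "i \<in> noncomm_idx" "2 \<le> card (center (S i))"
    | (c7) i where "2 \<le> card noncomm_idx" "i \<in> noncomm_idx"
        "center (S i) \<noteq> {}" "\<not> null_graph (commuting_graph (S i))"
    unfolding interaction_def by blast
  then show ?thesis
  proof cases
    case c1
    obtain k where k: "k \<in> noncomm_idx" using assms(1) by auto
    obtain a b c where abc: "a \<in> carrier (S i)" "b \<in> carrier (S i)" "c \<in> carrier (S i)"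
        "a \<noteq> b" "b \<noteq> c" "a \<noteq> c"
      using c1(2) by (rule card_ge_3E)
    show ?thesis
      using c1 k disj[OF c1(1) k] abc
      by (intro triangle_one_coordinate[of i k a b c]) (auto intro: comm_idx_index comm_idx_commute)
  next
    case c2
    obtain k where k: "k \<in> noncomm_idx" using assms(1) by auto
    obtain a b where ab: "a \<in> carrier (S i)" "b \<in> carrier (S i)" "a \<noteq> b"
      using c2(4) by (rule card_ge_2E)
    obtain c d where cd: "c \<in> carrier (S j)" "d \<in> carrier (S j)" "c \<noteq> d"
      using c2(5) by (rule card_ge_2E)
    have "\<exists>k\<in>noncomm_idx. k \<noteq> i \<and> k \<noteq> j"
      using k disj[OF c2(1) k] disj[OF c2(2) k] by auto
    with c2 ab cd show ?thesis
      by (intro triangle_two_pairs[of i j a b c d]) (auto intro: comm_idx_index comm_idx_commute)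
  next
    case c3
    obtain a b where ab: "a \<in> carrier (S i)" "b \<in> carrier (S i)" "a \<noteq> b"
      using c3(3) by (rule card_ge_2E)
    obtain s t where st: "s \<in> carrier (S j) - center (S j)" "t \<in> carrier (S j) - center (S j)"
        "s \<noteq> t" "s \<cdot>\<^bsub>S j\<^esub> t = t \<cdot>\<^bsub>S j\<^esub> s"
      using c3(4) by (rule not_null_commuting_graphE)
    show ?thesis
      using c3 ab st disj[OF c3(1,2)]
      by (intro triangle_two_pairs[of i j a b s t])
        (auto intro: comm_idx_index noncomm_idx_index comm_idx_commute)
  next
    case c4
    obtain a b where ab: "a \<in> carrier (S i)" "b \<in> carrier (S i)" "a \<noteq> b"
      using c4(4) by (rule card_ge_2E)
    obtain s t where st: "s \<in> carrier (S j) - center (S j)" "t \<in> carrier (S j)" "s \<noteq> t"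
        "s \<cdot>\<^bsub>S j\<^esub> t = t \<cdot>\<^bsub>S j\<^esub> s"
      using c4 noncentral_commuting_pair[of "S j"] by (auto simp: noncomm_idx_def)
    obtain k where k: "k \<in> noncomm_idx" "k \<noteq> j" using c4(1) by (rule other_noncomm_idx)
    have "\<exists>k\<in>noncomm_idx. k \<noteq> i \<and> k \<noteq> j"
      using k disj[OF c4(2) k(1)] by auto
    with c4 ab st disj[OF c4(2,3)] show ?thesis
      by (intro triangle_two_pairs[of i j a b s t])
        (auto intro: comm_idx_index noncomm_idx_index comm_idx_commute)
  next
    case c5
    obtain a b where ab: "a \<in> carrier (S i) - center (S i)" "b \<in> carrier (S i)" "a \<noteq> b"
        "a \<cdot>\<^bsub>S i\<^esub> b = b \<cdot>\<^bsub>S i\<^esub> a"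
      using c5 noncentral_commuting_pair[of "S i"] by (auto simp: noncomm_idx_def)
    obtain c d where cd: "c \<in> carrier (S j) - center (S j)" "d \<in> carrier (S j)" "c \<noteq> d"
        "c \<cdot>\<^bsub>S j\<^esub> d = d \<cdot>\<^bsub>S j\<^esub> c"
      using c5 noncentral_commuting_pair[of "S j"] by (auto simp: noncomm_idx_def)
    show ?thesis
      using c5 ab cd
      by (intro triangle_two_pairs[of i j a b c d]) (auto intro: noncomm_idx_index)
  next
    case c6
    obtain z z' where z: "z \<in> center (S i)" "z' \<in> center (S i)" "z \<noteq> z'"
      using c6(3) by (rule card_ge_2E)
    obtain s where s: "s \<in> carrier (S i) - center (S i)"
      using c6(2) by (auto simp: noncomm_idx_def elim: not_commutativeE)
    obtain k where k: "k \<in> noncomm_idx" "k \<noteq> i" using c6(1) by (rule other_noncomm_idx)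
    show ?thesis
      using c6 k z s
      by (intro triangle_one_coordinate[of i k z z' s])
        (auto intro: noncomm_idx_index center_commute center_carrier)
  next
    case c7
    then obtain z where z: "z \<in> center (S i)" by auto
    obtain s t where st: "s \<in> carrier (S i) - center (S i)" "t \<in> carrier (S i) - center (S i)"
        "s \<noteq> t" "s \<cdot>\<^bsub>S i\<^esub> t = t \<cdot>\<^bsub>S i\<^esub> s"
      using c7(4) by (rule not_null_commuting_graphE)
    obtain k where k: "k \<in> noncomm_idx" "k \<noteq> i" using c7(1) by (rule other_noncomm_idx)
    show ?thesis
      using c7 k z st
      by (intro triangle_one_coordinate[of i k z s t])
        (auto intro: noncomm_idx_index center_commute center_carrier)
  qed
qed

section \<open>Lifting and projecting cycles\<close>

lemma cycle_lifts:
  assumes k: "k \<in> I" and cyc: "graph_cycle (commuting_graph (S k)) p"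
  shows "\<exists>q. graph_cycle (commuting_graph P) q \<and> length q = length p"
proof -
  obtain x where x: "x \<in> carrier P" by (rule carrier_P_nonempty)
  let ?f = "\<lambda>a. x(k := a)"
  have vert: "?f a \<in> carrier P - center P" if "a \<in> carrier (S k) - center (S k)" for a
    using x k that by (intro noncentral_upd) auto
  have "inj ?f" by (metis fun_upd_same injI)
  then have "graph_cycle (commuting_graph P) (map (map_prod ?f ?f) p)"
    using cyc vert
    by (intro graph_cycle_map[of "commuting_graph (S k)"])
      (auto simp: mult_P_commute_iff inj_eq intro: inj_on_subset)
  then show ?thesis by force
qed

text \<open>
  Two differing commuting elements in each of two factors give condition 2 or 5, or, if one factor is
  commutative and the other is not, condition 3 or a central value in the non-commutative factor at
  an end of the edge that moves it. Being a vertex, this end is non-central at another coordinate,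
  which supplies the second non-commutative factor that condition 4 asks for.
\<close>

lemma arcs_move_same_coordinate:
  assumes none: "\<not> interaction"
    and uv: "(u, v) \<in> parcs (commuting_graph P)" and ij: "i \<in> I" "j \<in> I"
    and i: "u i \<noteq> v i"
    and uv': "(u', v') \<in> parcs (commuting_graph P)" and j: "u' j \<noteq> v' j"
  shows "i = j"
proof (rule ccontr)
  assume "i \<noteq> j"
  have pair: "x k \<in> carrier (S k)" "y k \<in> carrier (S k)" "x k \<cdot>\<^bsub>S k\<^esub> y k = y k \<cdot>\<^bsub>S k\<^esub> x k"
    if "(x, y) \<in> parcs (commuting_graph P)" "k \<in> I" for x y k
    using that by (auto simp: carrier_coord mult_P_commute_iff)
  have big: "2 \<le> card (carrier (S k))"
    if "(x, y) \<in> parcs (commuting_graph P)" "k \<in> I" "x k \<noteq> y k" for x y k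
    using that pair[OF that(1,2)] factor_finite by (intro card_ge_2I[of _ "x k" "y k"]) auto
  have nontrivial: "center (S k) \<noteq> {} \<or> \<not> null_graph (commuting_graph (S k))"
    if "(x, y) \<in> parcs (commuting_graph P)" "k \<in> I" "x k \<noteq> y k" for x y k
    using that(3) pair[OF that(1,2)]
    by (intro commuting_pair_imp_center_or_edge[of "x k" _ "y k"]) auto
  have mixed: False
    if xy: "(x, y) \<in> parcs (commuting_graph P)" and x'y': "(x', y') \<in> parcs (commuting_graph P)"
      and k: "k \<in> comm_idx" "x k \<noteq> y k" and l: "l \<in> noncomm_idx" "x' l \<noteq> y' l"
    for x y x' y' k l
  proof -
    have lI: "l \<in> I" using l(1) by (rule noncomm_idx_index)
    have two: "2 \<le> card (carrier (S k))" using big[OF xy _ k(2)] k(1) comm_idx_index by auto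
    then have "null_graph (commuting_graph (S l))"
      using none interactionI(3)[OF k(1) l(1)] by blast
    then have "x' l \<in> center (S l) \<or> y' l \<in> center (S l)"
      using pair[OF x'y' lI] l(2) by (auto simp: null_commuting_graph_iff)
    then obtain z where z: "z \<in> carrier P - center P" "z l \<in> center (S l)"
      using x'y' by auto
    obtain m where m: "m \<in> I" "z m \<notin> center (S m)" using z(1) center_P_iff by auto
    then have "m \<in> noncomm_idx" "m \<noteq> l" using z noncentral_coord_noncomm_idx by auto
    then have "2 \<le> card noncomm_idx" using l(1) finite_noncomm_idx card_ge_2I by metis
    then show False using none interactionI(4)[OF _ k(1) l(1) two z(2)] by blast
  qed
  have cases: "k \<in> comm_idx \<or> k \<in> noncomm_idx" if "k \<in> I" for k
    using that by (auto simp: comm_idx_def noncomm_idx_def)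
  consider "i \<in> comm_idx" "j \<in> comm_idx" | "i \<in> comm_idx" "j \<in> noncomm_idx"
    | "i \<in> noncomm_idx" "j \<in> comm_idx" | "i \<in> noncomm_idx" "j \<in> noncomm_idx"
    using cases ij by blast
  then show False
  proof cases
    case 1
    then show False
      using none interactionI(2)[of i j] \<open>i \<noteq> j\<close> big[OF uv ij(1)] big[OF uv' ij(2)] i j
      by blast
  next
    case 2
    then show False using mixed[OF uv uv'] i j by blast
  next
    case 3
    then show False using mixed[OF uv' uv] i j by blast
  next
    case 4
    then show False
      using none interactionI(5)[OF 4 \<open>i \<noteq> j\<close>] nontrivial[OF uv ij(1)] nontrivial[OF uv' ij(2)]
        i j
      by blast
  qed
qed

lemma pcas_agree:
  assumes "pcas u p v" and "\<And>x y. (x, y) \<in> set p \<Longrightarrow> f x = f y" and "y \<in> snd ` set p"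
  shows "f y = f u"
  using assms
proof (induction u p v rule: pcas.induct)
  case (2 u e es v)
  obtain w where e: "e = (u, w)" "pcas w es v" using "2.prems"(1) by (cases e) auto
  have uw: "f u = f w" using "2.prems"(2) e(1) by simp
  show ?case
  proof (cases "y \<in> snd ` set es")
    case True
    then have "f y = f w" using "2.IH" "2.prems"(2) e by simp
    then show ?thesis using uw by (rule trans[OF _ sym])
  next
    case False
    then show ?thesis using "2.prems"(3) e(1) uw by simp
  qed
qed simp

text \<open>
  Evaluation at the moved coordinate \<open>k\<close> is injective on the cycle because all its vertices agree
  elsewhere. The work lies in showing that it maps vertices to vertices, that is, to non-central
  elements.
\<close>

lemma cycle_projects:
  assumes none: "\<not> interaction" and cyc: "graph_cycle (commuting_graph P) p"
  shows "\<exists>k\<in>noncomm_idx. \<exists>q. graph_cycle (commuting_graph (S k)) q \<and> length q = length p"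
proof -
  obtain u v w x where uv: "(u, v) \<in> parcs (commuting_graph P)"
    and vw: "(v, w) \<in> parcs (commuting_graph P)" and wx: "(w, x) \<in> parcs (commuting_graph P)"
    and neq: "u \<noteq> w" "v \<noteq> x"
    using cyc by (rule graph_cycle_three_arcs)
  have moves: "\<exists>i\<in>I. a i \<noteq> b i" if "(a, b) \<in> parcs (commuting_graph P)" for a b
    using that carrier_eqI[of a b] by auto
  obtain k where k: "k \<in> I" "u k \<noteq> v k" using moves[OF uv] by auto
  have fixes_others: "a i = b i" if ab: "(a, b) \<in> parcs (commuting_graph P)" and "i \<noteq> k" for a b i
  proof (cases "i \<in> I")
    case True
    then show ?thesis using arcs_move_same_coordinate[OF none ab True k(1) _ uv k(2)] that(2) by auto
  next
    case False
    then show ?thesis using ab by (auto simp: carrier_P PiE_def extensional_def)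
  qed
  have moves_k: "a k \<noteq> b k" if "(a, b) \<in> parcs (commuting_graph P)" for a b
    using moves[OF that] fixes_others[OF that] by metis
  have uw: "u k \<noteq> w k"
    using neq(1) fixes_others[OF uv] fixes_others[OF vw] by (metis ext)
  have vx: "v k \<noteq> x k"
    using neq(2) fixes_others[OF vw] fixes_others[OF wx] by (metis ext)
  have coord: "a k \<in> carrier (S k)" if "a \<in> carrier P" for a
    using that k(1) by (rule carrier_coord)
  have "k \<notin> comm_idx"
  proof
    assume "k \<in> comm_idx"
    moreover have "3 \<le> card (carrier (S k))"
      using k uw moves_k[OF vw] uv vw
      by (intro card_ge_3I[of _ "u k" "v k" "w k"]) (auto intro: factor_finite coord)
    ultimately show False using none interactionI(1) by blast
  qed
  then have kNC: "k \<in> noncomm_idx" using k(1) by (auto simp: comm_idx_def noncomm_idx_def)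
  have vert: "a k \<notin> center (S k)" if a: "a \<in> carrier P - center P" for a
  proof
    assume z: "a k \<in> center (S k)"
    obtain j where j: "j \<in> I" "a j \<notin> center (S j)" using a center_P_iff by auto
    then have "j \<in> noncomm_idx" "j \<noteq> k" using a z noncentral_coord_noncomm_idx by auto
    then have two: "2 \<le> card noncomm_idx" using kNC finite_noncomm_idx card_ge_2I by metis
    have fin: "finite (center (S k))"
      using factor_finite[OF k(1)] by (rule rev_finite_subset) (auto simp: center_def)
    have unique: "c = a k" if "c \<in> center (S k)" for c
      using none interactionI(6)[OF two kNC] card_ge_2I[OF fin that z] by blast
    have null: "null_graph (commuting_graph (S k))"
      using none interactionI(7)[OF two kNC z] by blast
    have touch: "b k = a k \<or> c k = a k" if bc: "(b, c) \<in> parcs (commuting_graph P)" for b c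
    proof -
      have "b k \<cdot>\<^bsub>S k\<^esub> c k = c k \<cdot>\<^bsub>S k\<^esub> b k" "b \<in> carrier P" "c \<in> carrier P"
        using bc k(1) by (auto simp: mult_P_commute_iff)
      then show ?thesis
        using null moves_k[OF bc] unique coord unfolding null_commuting_graph_iff by metis
    qed
    \<comment> \<open>Exactly one end of each edge has the central value at \<open>k\<close>, so either \<open>u\<close> and \<open>w\<close> or \<open>v\<close> and \<open>x\<close>
      both have it.\<close>
    show False
      using touch[OF uv] touch[OF vw] touch[OF wx] moves_k[OF vw] uw vx by metis
  qed
  let ?f = "\<lambda>a. a k"
  obtain s where s: "set p \<subseteq> parcs (commuting_graph P)" "pcas s p s"
    using cyc by (auto simp: graph_cycle_iff)
  have agree: "a i = s i" if "a \<in> snd ` set p" "i \<noteq> k" for a i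
    by (rule pcas_agree[OF s(2) _ that(1)]) (use s(1) fixes_others that(2) in blast)
  have "inj_on ?f (snd ` set p)"
  proof (rule inj_onI)
    fix a b assume ab: "a \<in> snd ` set p" "b \<in> snd ` set p" and "a k = b k"
    then have "a i = b i" for i
      using agree[OF ab(1), of i] agree[OF ab(2), of i] by (cases "i = k") auto
    then show "a = b" by (rule ext)
  qed
  moreover have "(a k, b k) \<in> parcs (commuting_graph (S k))"
    if "(a, b) \<in> parcs (commuting_graph P)" for a b
    using that moves_k[OF that] vert[of a] vert[of b] coord k(1) by (auto simp: mult_P_commute_iff)
  ultimately have "graph_cycle (commuting_graph (S k)) (map (map_prod ?f ?f) p)"
    using cyc vert coord by (intro graph_cycle_map[of "commuting_graph P"]) auto
  with kNC show ?thesis by force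
qed

lemma girth_if_interaction:
  assumes "noncomm_idx \<noteq> {}" and "interaction"
  shows "girth (commuting_graph P) = 3"
proof (rule antisym)
  show "girth (commuting_graph P) \<le> 3"
    using triangle_if_interaction[OF assms] girth_le by (metis numeral_eq_enat)
  show "3 \<le> girth (commuting_graph P)"
    by (rule girth_ge) (use graph_cycle_length in \<open>auto simp: numeral_eq_enat\<close>)
qed

lemma contains_cycles_iff:
  assumes "noncomm_idx \<noteq> {}"
  shows "contains_cycles (commuting_graph P) \<longleftrightarrow>
    interaction \<or> (\<exists>i\<in>noncomm_idx. contains_cycles (commuting_graph (S i)))"
proof
  assume "contains_cycles (commuting_graph P)"
  then show "interaction \<or> (\<exists>i\<in>noncomm_idx. contains_cycles (commuting_graph (S i)))"
    using cycle_projects unfolding contains_cycles_def by blast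
next
  assume "interaction \<or> (\<exists>i\<in>noncomm_idx. contains_cycles (commuting_graph (S i)))"
  then show "contains_cycles (commuting_graph P)"
    using triangle_if_interaction[OF assms] cycle_lifts[OF noncomm_idx_index]
    unfolding contains_cycles_def by blast
qed

lemma cyclic_factor_unique:
  assumes "\<not> interaction"
    and "i \<in> noncomm_idx" "contains_cycles (commuting_graph (S i))"
    and "j \<in> noncomm_idx" "contains_cycles (commuting_graph (S j))"
  shows "i = j"
  using interactionI(5)[OF assms(2,4)] assms(1) contains_cycles_not_null[OF assms(3)]
    contains_cycles_not_null[OF assms(5)] by blast

lemma girth_eq_factor_girth:
  assumes none: "\<not> interaction"
    and i: "i \<in> noncomm_idx" "contains_cycles (commuting_graph (S i))"
  shows "girth (commuting_graph P) = girth (commuting_graph (S i))"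
proof (rule antisym)
  show "girth (commuting_graph P) \<le> girth (commuting_graph (S i))"
  proof (rule girth_ge)
    fix p assume "graph_cycle (commuting_graph (S i)) p"
    then obtain q where "graph_cycle (commuting_graph P) q" "length q = length p"
      using cycle_lifts[OF noncomm_idx_index[OF i(1)]] by blast
    then show "girth (commuting_graph P) \<le> enat (length p)"
      using girth_le[of _ q] by simp
  qed
  show "girth (commuting_graph (S i)) \<le> girth (commuting_graph P)"
  proof (rule girth_ge)
    fix p assume "graph_cycle (commuting_graph P) p"
    then obtain k q where k: "k \<in> noncomm_idx" "graph_cycle (commuting_graph (S k)) q"
      and len: "length q = length p"
      using cycle_projects[OF none] by blast
    have "k = i"
      using cyclic_factor_unique[OF none k(1) _ i] k(2) by (auto simp: contains_cycles_def)
    then show "girth (commuting_graph (S i)) \<le> enat (length p)"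
      using girth_le[OF k(2)] len by simp
  qed
qed

end

section \<open>The girth of the commuting graph of a direct product\<close>

theorem theorem4p9:
  fixes n :: nat and S :: "nat \<Rightarrow> 'a magma"
    and P :: "(nat \<Rightarrow> 'a) magma" and C NC :: "nat set"
    and c1 c2 c3 c4 c5 c6 c7 c8 :: bool
  assumes S: "\<And>i. i \<in> {1..n} \<Longrightarrow> finite_semigroup (S i)"
    and P: "P = direct_product {1..n} S"
    and C: "C = {i \<in> {1..n}. commutative (S i)}"
    and NC: "NC = {i \<in> {1..n}. \<not> commutative (S i)}"
    and NC_nonempty: "NC \<noteq> {}"
    and c1: "c1 \<longleftrightarrow> (\<exists>i\<in>C. card (carrier (S i)) \<ge> 3)"
    and c2: "c2 \<longleftrightarrow> (\<exists>i\<in>C. \<exists>j\<in>C. i \<noteq> j \<and>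
               card (carrier (S i)) \<ge> 2 \<and> card (carrier (S j)) \<ge> 2)"
    and c3: "c3 \<longleftrightarrow> (\<exists>i\<in>C. \<exists>j\<in>NC.
               card (carrier (S i)) \<ge> 2 \<and> \<not> null_graph (commuting_graph (S j)))"
    and c4: "c4 \<longleftrightarrow> card NC \<ge> 2 \<and> (\<exists>i\<in>C. \<exists>j\<in>NC.
               card (carrier (S i)) \<ge> 2 \<and> center (S j) \<noteq> {})"
    and c5: "c5 \<longleftrightarrow> (\<exists>i\<in>NC. \<exists>j\<in>NC. i \<noteq> j \<and>
               (center (S i) \<noteq> {} \<or> \<not> null_graph (commuting_graph (S i))) \<and>
               (center (S j) \<noteq> {} \<or> \<not> null_graph (commuting_graph (S j))))"
    and c6: "c6 \<longleftrightarrow> card NC \<ge> 2 \<and> (\<exists>i\<in>NC. card (center (S i)) \<ge> 2)"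
    and c7: "c7 \<longleftrightarrow> card NC \<ge> 2 \<and> (\<exists>i\<in>NC.
               center (S i) \<noteq> {} \<and> \<not> null_graph (commuting_graph (S i)))"
    and c8: "c8 \<longleftrightarrow> (\<exists>i\<in>NC. contains_cycles (commuting_graph (S i)))"
  shows "(contains_cycles (commuting_graph P) \<longleftrightarrow>
            c1 \<or> c2 \<or> c3 \<or> c4 \<or> c5 \<or> c6 \<or> c7 \<or> c8)
       \<and> (c1 \<or> c2 \<or> c3 \<or> c4 \<or> c5 \<or> c6 \<or> c7 \<longrightarrow> girth (commuting_graph P) = 3)
       \<and> (c8 \<and> \<not> (c1 \<or> c2 \<or> c3 \<or> c4 \<or> c5 \<or> c6 \<or> c7) \<longrightarrow>
            (\<exists>!i. i \<in> NC \<and> contains_cycles (commuting_graph (S i))) \<and>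
            (\<forall>i\<in>NC. contains_cycles (commuting_graph (S i)) \<longrightarrow>
               girth (commuting_graph P) = girth (commuting_graph (S i))))"
proof -
  interpret F: finite_semigroup_family "{1..n}" S
    by (rule finite_semigroup_family.intro) (auto intro: S)
  have idx: "F.comm_idx = C" "F.noncomm_idx = NC"
    unfolding F.comm_idx_def F.noncomm_idx_def C NC by (rule refl)+
  have inter: "F.interaction \<longleftrightarrow> c1 \<or> c2 \<or> c3 \<or> c4 \<or> c5 \<or> c6 \<or> c7"
    unfolding F.interaction_def idx c1 c2 c3 c4 c5 c6 c7 by (rule refl)
  have cycles: "contains_cycles (commuting_graph P) \<longleftrightarrow> F.interaction \<or> c8"
    using F.contains_cycles_iff NC_nonempty unfolding idx P c8 by blast
  have girth3: "girth (commuting_graph P) = 3" if "F.interaction"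
    using F.girth_if_interaction that NC_nonempty unfolding idx P by blast
  have unique: "\<exists>!i. i \<in> NC \<and> contains_cycles (commuting_graph (S i))" if "\<not> F.interaction" c8
    using F.cyclic_factor_unique[OF that(1)] that(2) unfolding idx c8 by blast
  have girth_eq: "girth (commuting_graph P) = girth (commuting_graph (S i))"
    if "\<not> F.interaction" "i \<in> NC" "contains_cycles (commuting_graph (S i))" for i
    using F.girth_eq_factor_girth that unfolding idx P by blast
  show ?thesis
  proof (intro conjI impI)
    show "contains_cycles (commuting_graph P) \<longleftrightarrow>
        c1 \<or> c2 \<or> c3 \<or> c4 \<or> c5 \<or> c6 \<or> c7 \<or> c8"
      unfolding cycles inter by (simp only: disj_assoc)
  next
    assume "c1 \<or> c2 \<or> c3 \<or> c4 \<or> c5 \<or> c6 \<or> c7"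
    then show "girth (commuting_graph P) = 3"
      unfolding inter[symmetric] by (rule girth3)
  next
    assume "c8 \<and> \<not> (c1 \<or> c2 \<or> c3 \<or> c4 \<or> c5 \<or> c6 \<or> c7)"
    then have *: "\<not> F.interaction" c8
      unfolding inter by (rule conjunct2, rule conjunct1)
    show "\<exists>!i. i \<in> NC \<and> contains_cycles (commuting_graph (S i))"
      using * by (rule unique)
    show "\<forall>i\<in>NC. contains_cycles (commuting_graph (S i)) \<longrightarrow>
        girth (commuting_graph P) = girth (commuting_graph (S i))"
      using girth_eq[OF *(1)] by blast
  qed
qed

end
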